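(* For every integer $n\ge 0$, the map $\sigma$ (defined in the context) is a bijection between the set $\mathcal{P}_{n+1}(12312)$ of $12312$-avoiding partitions of $[n+1]$ and the set $\mathcal{SH}_n$ of UH-free Schröder paths of semilength $n$.
   Context: A partition of $[m]=\{1,\dots,m\}$ with blocks $B_1,\dots,B_k$ (nonempty, disjoint, with union $[m]$), listed so that $\min B_1<\min B_2<\cdots<\min B_k$, is represented by its canonical sequential form: the word $\pi_1\pi_2\cdots\pi_m$ on $\{1,\dots,k\}$ with $\pi_i=j$ if and only if $i\in B_j$. Partitions are identified with these words. A partition $\pi$ avoids a partition (pattern) $\tau$ if the word $\pi$ has no (not necessarily contiguous) subsequence order-isomorphic to $\tau$; $\mathcal{P}_m(\tau)$ denotes the set of $\tau$-avoiding partitions of $[m]$. A Schröder path of semilength $n$ is a lattice path from $(0,0)$ to $(2n,0)$ that never goes below the $x$-axis and consists of up steps $U=(1,1)$, down steps $D=(1,-1)$ and horizontal steps $H=(2,0)$. It is UH-free if no up step is immediately followed by a horizontal step. $\mathcal{SH}_n$ is the set of UH-free Schröder paths of semilength $n$. Definition of $\sigma$. Let $\pi$ be a $12312$-avoiding partition of $[n+1]$ with $k$ blocks. If $\pi=1$, then $\sigma(\pi)$ is the empty path. Otherwise write $\pi$ uniquely as $1w_12w_2\cdots kw_k$, where the displayed letters $1,2,\dots,k$ are the left-to-right maxima of $\pi$ (the first occurrences of the letters) and each $w_i$ is a possibly empty word on $\{1,\dots,i\}$. For $1\le i\le k-1$ let $d_i$ be the number of occurrences of the letter $i$ to the right of the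 first occurrence of $i+1$. Read $\pi$ from left to right and build $\sigma(\pi)$ by appending steps as follows: the initial letter $1$ contributes nothing; when the left-to-right maximum $i\ge 2$ is read, append $d_{i-1}+1$ up steps followed by one down step; when a letter of $w_i$ that is less than $i$ is read, append one down step; when a letter of $w_i$ equal to $i$ is read, append one horizontal step. *)

theory Defs
  imports Main "HOL-Library.Disjoint_Sets" "HOL-Library.Sublist"
begin

text \<open>
  Words are 0-based lists, while set partitions live on \<open>{1..m}\<close> and blocks and letters
  are numbered from 1: the \<open>j\<close>-th block is \<open>Bs ! (j - 1)\<close>.
\<close>

definition canonical_form :: "nat \<Rightarrow> nat set list \<Rightarrow> nat list \<Rightarrow> bool" where
  "canonical_form m Bs w \<longleftrightarrow>
     partition_on {1..m} (set Bs) \<and>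
     sorted_wrt (\<lambda>A B. Min A < Min B) Bs \<and>
     length w = m \<and> set w \<subseteq> {1..length Bs} \<and>
     (\<forall>i\<in>{1..m}. \<forall>j\<in>{1..length Bs}. w ! (i - 1) = j \<longleftrightarrow> i \<in> Bs ! (j - 1))"

definition partitions :: "nat \<Rightarrow> nat list set" where
  "partitions m = {w. \<exists>Bs. canonical_form m Bs w}"

definition order_isomorphic :: "nat list \<Rightarrow> nat list \<Rightarrow> bool" where
  "order_isomorphic u v \<longleftrightarrow>
     length u = length v \<and>
     (\<forall>i<length u. \<forall>j<length u. u ! i < u ! j \<longleftrightarrow> v ! i < v ! j)"

definition avoids :: "nat list \<Rightarrow> nat list \<Rightarrow> bool" where
  "avoids w t \<longleftrightarrow> \<not> (\<exists>u. subseq u w \<and> order_isomorphic u t)"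

definition avoiding_partitions :: "nat \<Rightarrow> nat list \<Rightarrow> nat list set" where
  "avoiding_partitions m t = {w \<in> partitions m. avoids w t}"

datatype step = U | D | H

fun step_width :: "step \<Rightarrow> nat" where
  "step_width U = 1"
| "step_width D = 1"
| "step_width H = 2"

fun step_rise :: "step \<Rightarrow> int" where
  "step_rise U = 1"
| "step_rise D = -1"
| "step_rise H = 0"

definition path_width :: "step list \<Rightarrow> nat" where
  "path_width p = (\<Sum>s\<leftarrow>p. step_width s)"

definition path_height :: "step list \<Rightarrow> int" where
  "path_height p = (\<Sum>s\<leftarrow>p. step_rise s)"

definition schroeder_paths :: "nat \<Rightarrow> step list set" where
  "schroeder_paths n =
     {p. path_width p = 2 * n \<and> path_height p = 0 \<and> (\<forall>q. prefix q p \<longrightarrow> path_height q \<ge> 0)}"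

definition UH_free :: "step list \<Rightarrow> bool" where
  "UH_free p \<longleftrightarrow> \<not> sublist [U, H] p"

definition UH_free_schroeder_paths :: "nat \<Rightarrow> step list set" where
  "UH_free_schroeder_paths n = {p \<in> schroeder_paths n. UH_free p}"

text \<open>
  The suffix produced by \<open>dropWhile\<close> starts at the first occurrence of \<open>i + 1\<close>, which is
  itself not an \<open>i\<close> and hence does not contribute to the count.
\<close>

definition later_occurrences :: "nat list \<Rightarrow> nat \<Rightarrow> nat" where
  "later_occurrences w i = count_list (dropWhile (\<lambda>a. a \<noteq> i + 1) w) i"

text \<open>
  For a partition word, the maximum of the letters before position \<open>p\<close> is the most recent
  left-to-right maximum \<open>i\<close>; a letter at \<open>p\<close> not exceeding it belongs to the word
  \<open>w\<^sub>i\<close> in the factorization \<open>1 w\<^sub>1 2 w\<^sub>2 \<dots> k w\<^sub>k\<close>.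
\<close>

definition sigma_steps :: "nat list \<Rightarrow> nat \<Rightarrow> step list" where
  "sigma_steps w p =
     (let a = w ! p; i = Max (set (take p w)) in
        if a > i then replicate (later_occurrences w (a - 1) + 1) U @ [D]
        else if a < i then [D]
        else [H])"

text \<open>Position 0, the initial letter 1, contributes no steps.\<close>

definition sigma :: "nat list \<Rightarrow> step list" where
  "sigma w = concat (map (sigma_steps w) [1..<length w])"

end

theory Submission imports Defs begin

text \<open>
  After the first occurrence of a letter \<open>c\<close>, a \<open>12312\<close>-avoiding partition word must list its
  letters below \<open>c\<close> in weakly decreasing order. Hence the word is the output of a stack: reading
  the left-to-right maximum \<open>m + 1\<close> pushes \<open>d\<^sub>m\<close> copies of \<open>m\<close>, and every letter below the current
  maximum pops the stack. The height of the path \<open>\<sigma>(\<pi>)\<close> is the size of this stack, and a UH-free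
  Schroeder path splits uniquely into blocks \<open>U\<^bsup>d+1\<^esup>D\<close>, \<open>D\<close> and \<open>H\<close>, which drive the stack.
\<close>

section \<open>Partition words\<close>

text \<open>In \<open>growth m w\<close> and its relatives below, \<open>m\<close> is the maximum of the letters preceding \<open>w\<close>.\<close>

fun growth :: "nat \<Rightarrow> nat list \<Rightarrow> bool" where
  "growth m [] \<longleftrightarrow> True"
| "growth m (a # w) \<longleftrightarrow> 1 \<le> a \<and> a \<le> Suc m \<and> growth (max m a) w"

lemma insert_atLeastAtMost_max:
  fixes a m :: nat
  assumes "1 \<le> a" "a \<le> Suc m"
  shows "insert a {1..m} = {1..max m a}"
  using assms by (auto simp: max_def)

text \<open>A positional form that no longer mentions the running maximum: each letter is 1 or the
  successor of an earlier letter, with \<open>{1..m}\<close> standing for the letters read before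
  \<open>w\<close>. This is the form that block minima yield.\<close>

lemma growth_iff_nth:
  "growth m w \<longleftrightarrow> (\<forall>p<length w. w ! p \<in> Suc ` insert 0 ({1..m} \<union> set (take p w)))"
proof (induction w arbitrary: m)
  case Nil
  then show ?case by simp
next
  case (Cons a w)
  have "(\<forall>p<length (a # w). (a # w) ! p \<in> Suc ` insert 0 ({1..m} \<union> set (take p (a # w)))) \<longleftrightarrow>
      a \<in> Suc ` insert 0 {1..m} \<and>
      (\<forall>p<length w. w ! p \<in> Suc ` insert 0 (insert a {1..m} \<union> set (take p w)))"
    by (subst length_Cons, subst All_less_Suc2) simp
  also have "a \<in> Suc ` insert 0 {1..m} \<longleftrightarrow> 1 \<le> a \<and> a \<le> Suc m"
    by (cases a) (auto simp: image_iff)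
  finally have split: "(\<forall>p<length (a # w).
        (a # w) ! p \<in> Suc ` insert 0 ({1..m} \<union> set (take p (a # w)))) \<longleftrightarrow>
      (1 \<le> a \<and> a \<le> Suc m) \<and>
      (\<forall>p<length w. w ! p \<in> Suc ` insert 0 (insert a {1..m} \<union> set (take p w)))" .
  show ?case
  proof (cases "1 \<le> a \<and> a \<le> Suc m")
    case True
    then show ?thesis
      unfolding split growth.simps Cons.IH by (simp only: insert_atLeastAtMost_max simp_thms)
  next
    case False
    then show ?thesis unfolding split growth.simps by blast
  qed
qed

lemma growth_letter_pos: "growth m w \<Longrightarrow> a \<in> set w \<Longrightarrow> 1 \<le> a"
  by (induction m w rule: growth.induct) auto

text \<open>Descend through the values: \<open>w ! p - 1\<close> occurs at an earlier position
  \<open>q\<close>, and \<open>j\<close> either equals it or occurs before \<open>q\<close> by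
  strong induction.\<close>

lemma growth_smaller_letter_before:
  assumes "growth 0 w" "p < length w" "1 \<le> j" "j < w ! p"
  shows "j \<in> set (take p w)"
  using assms(2-4)
proof (induction p rule: less_induct)
  case (less p)
  have "w ! p \<in> Suc ` insert 0 (set (take p w))"
    using assms(1) less.prems(1) by (auto simp: growth_iff_nth)
  then have "w ! p - 1 \<in> set (take p w)"
    using less.prems by auto
  then obtain q where q: "q < p" "w ! q = w ! p - 1"
    by (auto simp: in_set_conv_nth)
  show ?case
  proof (cases "j = w ! q")
    case True
    then show ?thesis using q less.prems by (auto simp: in_set_conv_nth)
  next
    case False
    then have "j \<in> set (take q w)"
      using less.IH[of q] q less.prems by auto
    then show ?thesis
      using q set_take_subset_set_take[of q p w] by auto
  qed
qed

text \<open>The block of the letter \<open>a - 1\<close> has a smaller minimum than the block of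
  \<open>a\<close>, so \<open>a - 1\<close> occurs before any \<open>a\<close>.\<close>

lemma canonical_form_growth:
  assumes "canonical_form m Bs w"
  shows "growth 0 w"
  unfolding growth_iff_nth
proof (intro allI impI)
  fix p assume p: "p < length w"
  have part: "partition_on {1..m} (set Bs)" and sorted: "sorted_wrt (\<lambda>A B. Min A < Min B) Bs"
    and len: "length w = m" and letters: "set w \<subseteq> {1..length Bs}"
    and block: "\<And>i j. i \<in> {1..m} \<Longrightarrow> j \<in> {1..length Bs} \<Longrightarrow> w ! (i - 1) = j \<longleftrightarrow> i \<in> Bs ! (j - 1)"
    using assms by (auto simp: canonical_form_def)
  define a where "a = w ! p"
  have a: "a \<in> {1..length Bs}"
    using letters p nth_mem a_def by blast
  show "w ! p \<in> Suc ` insert 0 ({1..0} \<union> set (take p w))"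
  proof (cases "a = 1")
    case True
    then show ?thesis by (simp add: a_def)
  next
    case False
    with a have a2: "2 \<le> a" "a \<le> length Bs" by auto
    \<comment> \<open>Lists count from 0 and letters from 1: these are the blocks of the letters
      \<open>a - 1\<close> and \<open>a\<close>.\<close>
    let ?A = "Bs ! (a - 2)" and ?B = "Bs ! (a - 1)"
    have "?A \<in> set Bs" "?B \<in> set Bs" using a2 by auto
    then have AB: "?A \<subseteq> {1..m}" "?B \<subseteq> {1..m}" "?A \<noteq> {}"
      using part by (auto simp: partition_on_def)
    have "Min ?A < Min ?B"
      using sorted_wrt_nth_less[OF sorted, of "a - 2" "a - 1"] a2 by auto
    moreover have "Suc p \<in> ?B"
      using block[of "Suc p" a] p len a a_def by auto
    then have "Min ?B \<le> Suc p"
      using AB(2) finite_subset by (intro Min_le) auto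
    ultimately have less: "Min ?A < Suc p" by simp
    have pred: "a - 1 \<in> {1..length Bs}" "a - 1 - 1 = a - 2"
      using a2 by auto
    have mem: "Min ?A \<in> ?A"
      using AB finite_subset by (intro Min_in) auto
    then have "Min ?A \<in> {1..m}" using AB by blast
    then have "w ! (Min ?A - 1) = a - 1"
      using block[of "Min ?A" "a - 1"] mem a2 pred by simp
    then have "a - 1 \<in> set (take p w)"
      using less p \<open>Min ?A \<in> {1..m}\<close> by (auto simp: in_set_conv_nth intro!: exI[of _ "Min ?A - 1"])
    then have "Suc (a - 1) \<in> Suc ` set (take p w)" by blast
    then show ?thesis using a2 by (auto simp: a_def)
  qed
qed

text \<open>The blocks are the level sets of the word.\<close>

lemma growth_canonical_form:
  assumes "growth 0 w"
  shows "\<exists>Bs. canonical_form (length w) Bs w"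
proof -
  \<comment> \<open>Inserting 0 gives the empty word \<open>k = 0\<close> blocks.\<close>
  define k where "k = Max (insert 0 (set w))"
  define B where "B j = {i \<in> {1..length w}. w ! (i - 1) = j}" for j
  define Bs where "Bs = map B [1..<Suc k]"
  have "set w \<subseteq> {1..k}"
    using growth_letter_pos[OF assms] by (auto simp: k_def)
  moreover have "{1..k} \<subseteq> set w"
  proof
    fix j assume j: "j \<in> {1..k}"
    have "k \<in> insert 0 (set w)"
      unfolding k_def by (rule Max_in) auto
    with j obtain p where p: "p < length w" "w ! p = k"
      by (auto simp: in_set_conv_nth)
    show "j \<in> set w"
    proof (cases "j = k")
      case True
      then show ?thesis using p by auto
    next
      case False
      then show ?thesis
        using growth_smaller_letter_before[OF assms p(1), of j] j p(2) by (auto dest: in_set_takeD)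
    qed
  qed
  ultimately have set_w: "set w = {1..k}" by auto
  have set_Bs: "set Bs = B ` {1..k}"
    by (auto simp: Bs_def)
  have fin: "finite (B j)" for j
    by (simp add: B_def)
  have ne: "B j \<noteq> {}" if "j \<in> {1..k}" for j
  proof -
    from that set_w obtain p where "p < length w" "w ! p = j"
      by (metis in_set_conv_nth)
    then have "Suc p \<in> B j" by (auto simp: B_def)
    then show ?thesis by auto
  qed
  have "\<Union> (set Bs) = {1..length w}"
  proof
    show "\<Union> (set Bs) \<subseteq> {1..length w}" by (auto simp: set_Bs B_def)
    show "{1..length w} \<subseteq> \<Union> (set Bs)"
    proof
      fix i assume i: "i \<in> {1..length w}"
      then have "w ! (i - 1) \<in> {1..k}"
        unfolding set_w[symmetric] by (intro nth_mem) auto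
      moreover have "i \<in> B (w ! (i - 1))"
        using i by (simp add: B_def)
      ultimately show "i \<in> \<Union> (set Bs)" unfolding set_Bs by blast
    qed
  qed
  moreover have "{} \<notin> set Bs"
    using ne unfolding set_Bs by (metis imageE)
  moreover have "disjoint (set Bs)"
    by (auto simp: set_Bs disjoint_def B_def)
  ultimately have part: "partition_on {1..length w} (set Bs)"
    by (simp add: partition_on_def)
  \<comment> \<open>By the first occurrence of \<open>j\<close>, every smaller letter has already
    occurred.\<close>
  have min: "Min (B i) < Min (B j)" if "1 \<le> i" "i < j" "j \<le> k" for i j
  proof -
    have "Min (B j) \<in> B j"
      using that ne fin by (intro Min_in) auto
    then have mj: "1 \<le> Min (B j)" "Min (B j) \<le> length w" "w ! (Min (B j) - 1) = j"
      by (auto simp: B_def)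
    then have "i \<in> set (take (Min (B j) - 1) w)"
      using that by (intro growth_smaller_letter_before[OF assms]) auto
    then obtain q where q: "q < Min (B j) - 1" "q < length w" "w ! q = i"
      by (auto simp: in_set_conv_nth)
    then have "Suc q \<in> B i" by (auto simp: B_def)
    then have "Min (B i) \<le> Suc q" using fin by simp
    then show ?thesis using q by simp
  qed
  have "sorted_wrt (\<lambda>A B. Min A < Min B) Bs"
    unfolding sorted_wrt_iff_nth_less by (auto simp: Bs_def simp del: upt_Suc intro!: min)
  with part have "canonical_form (length w) Bs w"
    unfolding canonical_form_def
    by (auto simp: set_w Bs_def B_def simp del: upt_Suc)
  then show ?thesis by blast
qed

lemma partitions_eq_growth: "partitions m = {w. length w = m \<and> growth 0 w}"
proof (intro set_eqI iffI)
  fix w assume "w \<in> partitions m"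
  then obtain Bs where "canonical_form m Bs w" by (auto simp: partitions_def)
  then show "w \<in> {w. length w = m \<and> growth 0 w}"
    using canonical_form_growth by (auto simp: canonical_form_def)
next
  fix w assume "w \<in> {w. length w = m \<and> growth 0 w}"
  then show "w \<in> partitions m"
    using growth_canonical_form by (auto simp: partitions_def)
qed

section \<open>Pattern avoidance\<close>

text \<open>The sortedness clause expresses avoidance of 12312: an ascent \<open>x < y\<close> below
  \<open>m\<close> in the unread word would complete \<open>x, y, m, x, y\<close>.\<close>

fun admissible :: "nat \<Rightarrow> nat list \<Rightarrow> bool" where
  "admissible m [] \<longleftrightarrow> True"
| "admissible m (a # w) \<longleftrightarrow> 1 \<le> a \<and> a \<le> Suc m \<and>
     sorted_wrt (\<ge>) (filter (\<lambda>b. b < m) (a # w)) \<and> admissible (max m a) w"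

lemma admissible_growth: "admissible m w \<Longrightarrow> growth m w"
  by (induction m w rule: admissible.induct) auto

lemma admissible_sorted: "admissible m w \<Longrightarrow> sorted_wrt (\<ge>) (filter (\<lambda>b. b < m) w)"
  by (cases w) auto

lemma subseq_pair_iff_not_sorted:
  "\<not> sorted_wrt (\<ge>) (w :: nat list) \<longleftrightarrow> (\<exists>x y. x < y \<and> subseq [x, y] w)"
proof (induction w)
  case Nil
  then show ?case by simp
next
  case (Cons a w)
  have "\<not> sorted_wrt (\<ge>) (a # w) \<longleftrightarrow> (\<exists>y\<in>set w. a < y) \<or> (\<exists>x y. x < y \<and> subseq [x, y] w)"
    using Cons.IH by (auto simp: not_le)
  also have "\<dots> \<longleftrightarrow> (\<exists>x y. x < y \<and> subseq [x, y] (a # w))"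
  proof
    assume "(\<exists>y\<in>set w. a < y) \<or> (\<exists>x y. x < y \<and> subseq [x, y] w)"
    then show "\<exists>x y. x < y \<and> subseq [x, y] (a # w)"
    proof
      assume "\<exists>y\<in>set w. a < y"
      then obtain y where "a < y" "subseq [a, y] (a # w)"
        by (auto simp: subseq_singleton_left)
      then show ?thesis by blast
    next
      assume "\<exists>x y. x < y \<and> subseq [x, y] w"
      then show ?thesis by blast
    qed
  qed (auto simp: subseq_singleton_left split: if_splits)
  finally show ?case .
qed

lemma order_isomorphic_12312:
  "order_isomorphic u [1, 2, 3, 1, 2] \<longleftrightarrow> (\<exists>x y z. x < y \<and> y < z \<and> u = [x, y, z, x, y])"
proof
  assume iso: "order_isomorphic u [1, 2, 3, 1, 2]"
  then have "length u = 5" by (simp add: order_isomorphic_def)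
  then obtain a b c d e where u: "u = [a, b, c, d, e]"
    by (auto simp: numeral_eq_Suc length_Suc_conv)
  \<comment> \<open>Repeated letters of the pattern exclude both strict inequalities, whence
    \<open>a = d\<close> and \<open>b = e\<close>.\<close>
  from iso have "a < b" "b < c" "\<not> a < d" "\<not> d < a" "\<not> b < e" "\<not> e < b"
    by (auto simp: order_isomorphic_def u less_Suc_eq numeral_eq_Suc All_less_Suc2)
  then show "\<exists>x y z. x < y \<and> y < z \<and> u = [x, y, z, x, y]"
    using u by auto
next
  assume "\<exists>x y z. x < y \<and> y < z \<and> u = [x, y, z, x, y]"
  then show "order_isomorphic u [1, 2, 3, 1, 2]"
    by (auto simp: order_isomorphic_def less_Suc_eq numeral_eq_Suc All_less_Suc2)
qed

text \<open>Once \<open>z\<close> is read, \<open>x\<close> and \<open>y\<close> lie below the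
  running maximum, so the remaining word cannot contain them in ascending order.\<close>

lemma admissible_not_subseq:
  assumes "admissible m w" "x < y" "y < z"
  shows "\<not> subseq [z, x, y] w"
  using assms(1)
proof (induction m w rule: admissible.induct)
  case (1 m)
  then show ?case by simp
next
  case (2 m a w)
  have "\<not> subseq [x, y] w" if "a = z"
  proof
    assume "subseq [x, y] w"
    then have "subseq (filter (\<lambda>b. b < max m a) [x, y]) (filter (\<lambda>b. b < max m a) w)"
      by (rule subseq_filter)
    moreover have "filter (\<lambda>b. b < max m a) [x, y] = [x, y]"
      using assms(2,3) that by auto
    ultimately have "\<not> sorted_wrt (\<ge>) (filter (\<lambda>b. b < max m a) w)"
      using subseq_pair_iff_not_sorted assms(2) by metis
    then show False
      using 2 admissible_sorted[of "max m a" w] by simp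
  qed
  then show ?case using 2 by (auto split: if_splits)
qed

text \<open>The prefix \<open>u\<close> contains 1, ..., \<open>m\<close> in increasing order and
  thus supplies the first half \<open>x, y, m\<close> of the pattern; an ascent \<open>x < y\<close>
  in the rest would supply the second half.\<close>

lemma avoids_admissible:
  assumes "avoids (u @ w) [1, 2, 3, 1, 2]" "growth m w" "subseq [1..<Suc m] u"
  shows "admissible m w"
  using assms
proof (induction w arbitrary: u m)
  case Nil
  then show ?case by simp
next
  case (Cons a w)
  have "subseq [1..<Suc (max m a)] (u @ [a])"
  proof (cases "a \<le> m")
    case True
    then show ?thesis using list_emb_prefix[OF Cons.prems(3), of "[a]"] by (simp add: max_absorb1)
  next
    case False
    then have "a = Suc m" using Cons.prems(2) by simp
    then show ?thesis
      using list_emb_append_mono[OF Cons.prems(3), of "[a]" "[a]"] by simp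
  qed
  then have "admissible (max m a) w"
    using Cons.IH[of "u @ [a]" "max m a"] Cons.prems by simp
  moreover have "sorted_wrt (\<ge>) (filter (\<lambda>b. b < m) (a # w))"
  proof (rule ccontr)
    assume "\<not> ?thesis"
    then obtain x y where xy: "x < y" "subseq [x, y] (filter (\<lambda>b. b < m) (a # w))"
      using subseq_pair_iff_not_sorted by blast
    then have sub: "subseq [x, y] (a # w)"
      using subseq_order.trans subseq_filter_left by blast
    have "set [x, y] \<subseteq> set (filter (\<lambda>b. b < m) (a # w))"
      using xy(2) unfolding subseq_conv_nths by (metis set_nths_subset)
    then have "x \<in> set (a # w)" "y < m"
      unfolding set_filter by auto
    then have "1 \<le> x"
      using growth_letter_pos[OF Cons.prems(2)] by blast
    \<comment> \<open>Selecting three values from the increasing list exhibits them as a subsequence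
      of it, hence of \<open>u\<close>.\<close>
    then have "filter (\<lambda>b. b \<in> {x, y, m}) [1..<Suc m] = [x, y, m]"
      using xy(1) \<open>y < m\<close>
      by (intro sorted_distinct_set_unique) (auto simp: sorted_wrt_filter simp del: upt_Suc)
    then have "subseq [x, y, m] u"
      using subseq_filter_left subseq_order.trans Cons.prems(3) by metis
    then have "subseq [x, y, m, x, y] (u @ a # w)"
      using list_emb_append_mono[OF _ sub, of "[x, y, m]" u] by simp
    moreover have "order_isomorphic [x, y, m, x, y] [1, 2, 3, 1, 2]"
      using xy(1) \<open>y < m\<close> by (simp only: order_isomorphic_12312) blast
    ultimately show False using Cons.prems(1) by (auto simp: avoids_def)
  qed
  ultimately show ?case using Cons.prems(2) by simp
qed

lemma avoiding_partitions_12312: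
  "avoiding_partitions (n + 1) [1, 2, 3, 1, 2] = (#) 1 ` {w. length w = n \<and> admissible 1 w}"
    (is "?L = ?R")
proof (intro set_eqI iffI)
  fix v assume v: "v \<in> ?L"
  then have "length v = Suc n" "growth 0 v"
    by (auto simp: avoiding_partitions_def partitions_eq_growth)
  then obtain w where w: "v = 1 # w" "length w = n" "growth 1 w"
    by (cases v) (auto simp: le_Suc_eq)
  have "admissible 1 w"
    using v w by (intro avoids_admissible[of "[1]"]) (auto simp: avoiding_partitions_def)
  with w show "v \<in> ?R" by auto
next
  fix v assume "v \<in> ?R"
  then obtain w where w: "v = 1 # w" "length w = n" "admissible 1 w" by auto
  have "avoids v [1, 2, 3, 1, 2]"
    unfolding avoids_def order_isomorphic_12312
  proof clarify
    fix x y z :: nat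
    assume *: "subseq [x, y, z, x, y] v" "x < y" "y < z"
    \<comment> \<open>The initial 1 can serve only as the first letter of the occurrence; the other
      four lie in \<open>w\<close>.\<close>
    from *(1) have "subseq [y, z, x, y] w"
      unfolding w(1) by (auto dest: subseq_Cons' split: if_splits)
    then have "subseq [z, x, y] w" by (rule subseq_Cons')
    with admissible_not_subseq[OF w(3) *(2,3)] show False by blast
  qed
  then show "v \<in> ?L"
    using w admissible_growth[OF w(3)] by (auto simp: avoiding_partitions_def partitions_eq_growth)
qed

section \<open>The encoding by suffixes\<close>

text \<open>The map \<sigma> as a recursion on the unread suffix: when the maximum rises above
  \<open>m\<close>, the number \<open>d\<^sub>m\<close> counts the letters \<open>m\<close> in that
  suffix alone.\<close>

fun encode :: "nat \<Rightarrow> nat list \<Rightarrow> step list" where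
  "encode m [] = []"
| "encode m (a # w) =
     (if a > m then replicate (Suc (count_list w m)) U @ D # encode a w
      else if a < m then D # encode m w
      else H # encode m w)"

lemma sigma_steps_encode:
  assumes "growth m w" "set u = {1..m}" "u \<noteq> []"
  shows "concat (map (sigma_steps (u @ w)) [length u..<length u + length w]) = encode m w"
  using assms
proof (induction w arbitrary: u m)
  case Nil
  then show ?case by simp
next
  case (Cons a w)
  have a: "1 \<le> a" "a \<le> Suc m" "growth (max m a) w"
    using Cons.prems(1) by auto
  have "m \<ge> 1" using Cons.prems(2,3) by (cases m) auto
  then have "Max (set u) = m"
    using Cons.prems(2) by (auto intro!: Max_eqI)
  \<comment> \<open>All letters of \<open>u\<close> are at most \<open>m\<close>, so the displayed
    \<open>Suc m\<close> is its first occurrence.\<close>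
  have "dropWhile (\<lambda>b. b \<noteq> Suc m) (u @ Suc m # w) = Suc m # w"
    using Cons.prems(2) by (subst dropWhile_append2) auto
  then have later: "later_occurrences (u @ Suc m # w) m = count_list w m"
    by (simp add: later_occurrences_def)
  have steps: "sigma_steps (u @ a # w) (length u) =
      (if a > m then replicate (Suc (count_list w m)) U @ [D] else if a < m then [D] else [H])"
    using a later \<open>Max (set u) = m\<close> by (auto simp: sigma_steps_def le_Suc_eq)
  have "set (u @ [a]) = {1..max m a}"
    using insert_atLeastAtMost_max[of a m] a Cons.prems(2) by simp
  then have "concat (map (sigma_steps (u @ a # w)) [Suc (length u)..<length u + Suc (length w)]) =
      encode (max m a) w"
    using Cons.IH[of "max m a" "u @ [a]"] a by simp
  then show ?case
    using steps by (subst upt_conv_Cons) (auto simp: max_def)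
qed

lemma sigma_eq_encode: "admissible 1 w \<Longrightarrow> sigma (1 # w) = encode 1 w"
  using sigma_steps_encode[of 1 w "[1]"] admissible_growth[of 1 w] by (simp add: sigma_def)

section \<open>Schroeder paths\<close>

text \<open>Paths from height \<open>h\<close> to the axis that stay weakly above it. A natural
  number as height can be matched with the size of the stack.\<close>

fun returns :: "nat \<Rightarrow> step list \<Rightarrow> bool" where
  "returns h [] \<longleftrightarrow> h = 0"
| "returns h (U # p) \<longleftrightarrow> returns (Suc h) p"
| "returns h (D # p) \<longleftrightarrow> 0 < h \<and> returns (h - 1) p"
| "returns h (H # p) \<longleftrightarrow> returns h p"

lemma path_height_simps [simp]:
  "path_height [] = 0" "path_height (s # p) = step_rise s + path_height p"
  by (simp_all add: path_height_def)

lemma path_width_simps [simp]: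
  "path_width [] = 0" "path_width (s # p) = step_width s + path_width p"
  "path_width (p @ q) = path_width p + path_width q"
  by (simp_all add: path_width_def)

lemma path_width_replicate_U [simp]: "path_width (replicate d U) = d"
  by (induction d) auto

lemma all_prefix_Cons:
  "(\<forall>q. prefix q (s # p) \<longrightarrow> P q) \<longleftrightarrow> P [] \<and> (\<forall>q. prefix q p \<longrightarrow> P (s # q))"
  by (auto simp: prefix_Cons)

lemma returns_iff:
  "returns h p \<longleftrightarrow> int h + path_height p = 0 \<and> (\<forall>q. prefix q p \<longrightarrow> 0 \<le> int h + path_height q)"
proof (induction h p rule: returns.induct)
  case (1 h)
  then show ?case by auto
next
  case (2 h p)
  then show ?case by (simp add: all_prefix_Cons algebra_simps)
next
  case (3 h p)
  \<comment> \<open>The empty prefix after a down step gives the guard \<open>0 < h\<close>.\<close>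
  have "0 \<le> int h - 1 + path_height []" if "\<forall>q. prefix q p \<longrightarrow> 0 \<le> int h - 1 + path_height q"
    using that[rule_format, of "[]"] by simp
  with 3 show ?case by (cases h) (auto simp: all_prefix_Cons algebra_simps)
next
  case (4 h p)
  then show ?case by (simp add: all_prefix_Cons)
qed

lemma schroeder_paths_eq_returns: "schroeder_paths n = {p. path_width p = 2 * n \<and> returns 0 p}"
  by (auto simp: schroeder_paths_def returns_iff)

lemma returns_replicate_U [simp]: "returns h (replicate d U @ p) \<longleftrightarrow> returns (h + d) p"
  by (induction d arbitrary: h) auto

lemma UH_free_Nil [simp]: "UH_free []"
  by (simp add: UH_free_def)

lemma UH_free_Cons [simp]:
  "UH_free (s # p) \<longleftrightarrow> (s = U \<longrightarrow> p = [] \<or> hd p \<noteq> H) \<and> UH_free p"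
  by (cases p) (auto simp: UH_free_def sublist_Cons_right)

lemma UH_free_replicate_U [simp]: "UH_free (replicate d U @ D # p) \<longleftrightarrow> UH_free p"
proof (induction d)
  case (Suc d)
  then show ?case by (cases d) auto
qed simp

text \<open>A run of up steps cannot be followed by \<open>H\<close>, nor can it end the path, which
  must come back to height 0; so \<open>D\<close> follows.\<close>

lemma UH_free_U_block:
  assumes "UH_free (U # p)" "returns h (U # p)"
  shows "\<exists>d q. U # p = replicate (Suc d) U @ D # q"
  using assms
proof (induction p arbitrary: h)
  case Nil
  then show ?case by simp
next
  case (Cons s p)
  show ?case
  proof (cases s)
    case U
    then obtain d q where "U # p = replicate (Suc d) U @ D # q"
      using Cons.IH[of "Suc h"] Cons.prems by auto
    then have "U # s # p = replicate (Suc (Suc d)) U @ D # q"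
      using U by simp
    then show ?thesis by blast
  next
    case D
    then show ?thesis by (intro exI[of _ 0]) simp
  next
    case H
    then show ?thesis using Cons.prems(1) by simp
  qed
qed

section \<open>The stack of pending letters\<close>

text \<open>Among weakly decreasing letters up to \<open>m\<close>, the copies of \<open>m\<close>
  come first.\<close>

lemma sorted_filter_less_Suc:
  assumes "sorted_wrt (\<ge>) (filter (\<lambda>b. b < Suc m) w)"
  shows "filter (\<lambda>b. b < Suc m) w = replicate (count_list w m) m @ filter (\<lambda>b. b < m) w"
  using assms
proof (induction w)
  case Nil
  then show ?case by simp
next
  case (Cons a w)
  have IH: "filter (\<lambda>b. b < Suc m) w = replicate (count_list w m) m @ filter (\<lambda>b. b < m) w"
    using Cons by (auto split: if_splits)
  show ?case
  proof (cases "a < m")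
    case True
    then have "m \<notin> set w"
      using Cons.prems by auto
    then show ?thesis using IH True by (simp add: count_notin)
  next
    case False
    then show ?thesis using IH by auto
  qed
qed

text \<open>The push at a new maximum: the letters of \<open>w\<close> below \<open>m\<close> are
  the old stack, and the later copies of \<open>m\<close> go on top.\<close>

lemma admissible_filter_less_Suc:
  "admissible (Suc m) w \<Longrightarrow>
    filter (\<lambda>b. b < Suc m) w = replicate (count_list w m) m @ filter (\<lambda>b. b < m) w"
  by (intro sorted_filter_less_Suc admissible_sorted)

text \<open>The cases produce the blocks \<open>D\<close> (pop), \<open>H\<close> (stack unchanged)
  and a run of \<open>U\<close> followed by \<open>D\<close> (push).\<close>

lemma admissible_Cons_cases:
  assumes "admissible m (a # w)"
  obtains "a < m" "admissible m w" | "a = m" "admissible m w" | "a = Suc m" "admissible (Suc m) w"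
  using assms by (cases "a < m"; cases "a = m") (auto simp: max_def le_Suc_eq)

text \<open>The pending letters below \<open>m\<close> form the stack, whose size is the height.
  Each letter accounts for 2 in width plus stack size: a pop has width 1 and removes one entry,
  \<open>H\<close> has width 2, and a push of \<open>c\<close> entries has width
  \<open>c + 2\<close>.\<close>

lemma encode_path:
  assumes "admissible m w"
  shows "returns (length (filter (\<lambda>b. b < m) w)) (encode m w) \<and> UH_free (encode m w) \<and>
    path_width (encode m w) + length (filter (\<lambda>b. b < m) w) = 2 * length w"
  using assms
proof (induction w arbitrary: m)
  case Nil
  then show ?case by simp
next
  case (Cons a w)
  from Cons.prems show ?case
  proof (cases rule: admissible_Cons_cases)
    case 1
    then show ?thesis using Cons.IH[of m] by simp
  next
    case 2
    then show ?thesis using Cons.IH[of m] by simp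
  next
    case 3
    let ?c = "count_list w m"
    have "UH_free (replicate (Suc ?c) U @ D # encode (Suc m) w)"
      using Cons.IH[OF 3(2)] by (simp only: UH_free_replicate_U)
    then show ?thesis
      using Cons.IH[OF 3(2)] admissible_filter_less_Suc[OF 3(2)] 3(1) by (simp add: add_ac)
  qed
qed

section \<open>Decoding: recovering the word from its path\<close>

lemma replicate_U_D_inject:
  "replicate d U @ D # p = replicate e U @ D # q \<longleftrightarrow> d = e \<and> p = q"
proof (induction d arbitrary: e)
  case 0
  then show ?case by (cases e) auto
next
  case (Suc d)
  then show ?case by (cases e) auto
qed

text \<open>The first step of the path decides between pop, \<open>H\<close> and push. A popped
  letter is the top of the common stack, and a pushed block reveals its size through the run of up
  steps.\<close>

lemma encode_inject:
  assumes "admissible m w" "admissible m v" "encode m w = encode m v"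
    "filter (\<lambda>b. b < m) w = filter (\<lambda>b. b < m) v"
  shows "w = v"
  using assms
proof (induction w arbitrary: m v)
  case Nil
  then show ?case by (cases v) (auto split: if_splits)
next
  case (Cons a w)
  then obtain b v' where v: "v = b # v'"
    by (cases v) (auto split: if_splits)
  note IH = Cons.IH[of _ v'] and adm = Cons.prems(2)[unfolded v]
    and prems = Cons.prems(3,4)[unfolded v]
  from Cons.prems(1) show ?case
  proof (cases rule: admissible_Cons_cases)
    case 1
    from adm show ?thesis
      by (cases rule: admissible_Cons_cases) (use 1 IH[of m] prems v in auto)
  next
    case 2
    from adm show ?thesis
      by (cases rule: admissible_Cons_cases) (use 2 IH[of m] prems v in auto)
  next
    case 3
    from adm show ?thesis
    proof (cases rule: admissible_Cons_cases)
      case b: 3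
      have "replicate (Suc (count_list w m)) U @ D # encode (Suc m) w =
          replicate (Suc (count_list v' m)) U @ D # encode (Suc m) v'"
        using prems(1) 3(1) b(1) by simp
      then have "count_list w m = count_list v' m" "encode (Suc m) w = encode (Suc m) v'"
        by (simp_all only: replicate_U_D_inject nat.inject)
      moreover have "filter (\<lambda>b. b < m) w = filter (\<lambda>b. b < m) v'"
        using prems(2) 3(1) b(1) by simp
      \<comment> \<open>Equal counts of \<open>m\<close> on top of equal old stacks give equal new
        stacks, as the induction hypothesis requires.\<close>
      ultimately have "w = v'"
        using IH[of "Suc m"] 3(2) b(2) by (simp add: admissible_filter_less_Suc)
      then show ?thesis using v 3(1) b(1) by simp
    qed (use 3 prems in auto)
  qed
qed

text \<open>Run the path as a program on the stack \<open>st\<close>: \<open>H\<close> writes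
  \<open>m\<close>, \<open>D\<close> writes and pops the top, and a block of \<open>d + 1\<close> up
  steps and a \<open>D\<close> writes \<open>Suc m\<close> and pushes \<open>d\<close> copies of
  \<open>m\<close>. Pushed letters exceed those below them, so the stack stays sorted.\<close>

lemma encode_surject:
  assumes "returns (length st) p" "UH_free p" "sorted_wrt (\<ge>) st" "set st \<subseteq> {1..<m}" "1 \<le> m"
  shows "\<exists>w. admissible m w \<and> filter (\<lambda>b. b < m) w = st \<and> encode m w = p"
  using assms
\<comment> \<open>Induction is on length because a block starting with \<open>U\<close> is consumed
  as a whole.\<close>
proof (induction p arbitrary: m st rule: length_induct)
  case (1 p)
  show ?case
  proof (cases p)
    case Nil
    then show ?thesis using "1.prems" by (intro exI[of _ "[]"]) simp
  next
    case (Cons s q)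
    show ?thesis
    proof (cases s)
      case H
      then obtain w where "admissible m w" "filter (\<lambda>b. b < m) w = st" "encode m w = q"
        using "1.IH"[rule_format, of q st m] "1.prems" Cons by auto
      then show ?thesis
        using H Cons "1.prems" by (intro exI[of _ "m # w"]) auto
    next
      case D
      with Cons "1.prems"(1) obtain a st' where st: "st = a # st'"
        by (cases st) auto
      then obtain w where "admissible m w" "filter (\<lambda>b. b < m) w = st'" "encode m w = q"
        using "1.IH"[rule_format, of q st' m] "1.prems" Cons D by auto
      then show ?thesis
        using D Cons "1.prems" st by (intro exI[of _ "a # w"]) (auto simp: max_def)
    next
      case U
      then obtain d r where p: "p = replicate (Suc d) U @ D # r"
        using UH_free_U_block "1.prems"(1,2) Cons by metis
      have "UH_free r"
        using "1.prems"(2) unfolding p UH_free_replicate_U .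
      moreover have "returns (length (replicate d m @ st)) r"
        using "1.prems"(1) unfolding p returns_replicate_U by (simp add: add_ac)
      moreover have "sorted_wrt (\<ge>) (replicate d m)"
        by (induction d) auto
      then have "sorted_wrt (\<ge>) (replicate d m @ st)"
        using "1.prems"(3,4) by (auto simp: sorted_wrt_append)
      moreover have "set (replicate d m @ st) \<subseteq> {1..<Suc m}"
        using "1.prems"(4,5) by auto
      ultimately obtain w where w: "admissible (Suc m) w"
          "filter (\<lambda>b. b < Suc m) w = replicate d m @ st" "encode (Suc m) w = r"
        using "1.IH"[rule_format, of r "replicate d m @ st" "Suc m"] by (auto simp: p)
      \<comment> \<open>Discarding the pushed copies of \<open>m\<close> restores the old stack
        \<open>st\<close>.\<close>
      have "filter (\<lambda>b. b < m) w = filter (\<lambda>b. b < m) (filter (\<lambda>b. b < Suc m) w)"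
        by (auto intro: filter_cong)
      also have "\<dots> = st"
        unfolding w(2) using "1.prems"(4) by (auto simp: filter_id_conv)
      finally have st: "filter (\<lambda>b. b < m) w = st" .
      \<comment> \<open>Comparing lengths of the two descriptions of the new stack shows that
        \<open>encode\<close> emits exactly \<open>d + 1\<close> up steps.\<close>
      have "count_list w m = d"
        using admissible_filter_less_Suc[OF w(1)] w(2) st by (auto dest: arg_cong[of _ _ length])
      then show ?thesis
        using w st "1.prems"(3) p by (intro exI[of _ "Suc m # w"]) auto
    qed
  qed
qed

section \<open>Assembly: from tails of words to partitions with their initial 1\<close>

theorem theorem2:
  fixes n :: nat
  shows "bij_betw sigma (avoiding_partitions (n + 1) [1, 2, 3, 1, 2]) (UH_free_schroeder_paths n)"
proof -
  let ?W = "{w. length w = n \<and> admissible 1 w}"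
  \<comment> \<open>No letter lies below 1: the stack starts empty, so paths start at height 0 and
    have width twice the number of letters.\<close>
  have none: "filter (\<lambda>b. b < 1) w = []" if "admissible 1 w" for w
    using growth_letter_pos[OF admissible_growth[OF that]] by (fastforce simp: filter_empty_conv)
  have "bij_betw (encode 1) ?W (UH_free_schroeder_paths n)"
  proof (rule bij_betw_imageI)
    show "inj_on (encode 1) ?W"
    proof (rule inj_onI)
      fix w v assume "w \<in> ?W" "v \<in> ?W" "encode 1 w = encode 1 v"
      then show "w = v"
        using encode_inject[of 1 w v] none[of w] none[of v] by simp
    qed
    show "encode 1 ` ?W = UH_free_schroeder_paths n"
    proof (intro set_eqI iffI)
      fix p assume "p \<in> encode 1 ` ?W"
      then obtain w where w: "p = encode 1 w" "length w = n" "admissible 1 w" by auto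
      then show "p \<in> UH_free_schroeder_paths n"
        using encode_path[OF w(3)] none[OF w(3)]
        by (simp add: UH_free_schroeder_paths_def schroeder_paths_eq_returns)
    next
      fix p assume "p \<in> UH_free_schroeder_paths n"
      then have p: "path_width p = 2 * n" "returns 0 p" "UH_free p"
        by (auto simp: UH_free_schroeder_paths_def schroeder_paths_eq_returns)
      then obtain w where w: "admissible 1 w" "encode 1 w = p"
        using encode_surject[of "[]" p 1] by auto
      then have "length w = n"
        using encode_path[OF w(1)] none[OF w(1)] p(1) by simp
      with w show "p \<in> encode 1 ` ?W" by auto
    qed
  qed
  \<comment> \<open>Prepending the initial 1 is itself a bijection onto the avoiding partitions and
    can be cancelled from this composition.\<close>
  then have "bij_betw (sigma \<circ> (#) 1) ?W (UH_free_schroeder_paths n)"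
    by (rule bij_betw_cong[THEN iffD1, rotated]) (use sigma_eq_encode in auto)
  moreover have "bij_betw ((#) 1) ?W (avoiding_partitions (n + 1) [1, 2, 3, 1, 2])"
    unfolding avoiding_partitions_12312 by (simp add: bij_betw_def inj_on_def)
  ultimately show ?thesis
    using bij_betw_comp_iff by blast
qed

end
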